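(* Let $A\in\mathbb{R}^{n\times n}$, $C\in\mathbb{R}^{p\times n}$, and let $N:\mathbb{R}^n\to\mathbb{R}^{n\times n}$ be linear with $x^\top N(x)x=0$ for all $x\in\mathbb{R}^n$. Assume there is some $d'\in\mathbb{R}^n$ with $A_{d'}\prec 0$. Let $(x(t))_{t\ge0}$ be the solution of $\dot x=Ax+N(x)x$, $x(0)=x_0\in\mathbb{R}^n$, with output $y(t)=Cx(t)$. Suppose that $B_r(d)$ is invariant for $(x(t))_{t\ge0}$ and that $Y\subset\mathbb{R}^n$ satisfies $B_r(d)\subseteq Y$. Suppose that there exist $\alpha_1,\alpha_2,\alpha_3>0$, a symmetric matrix $P\in\mathcal{S}^n$ and $R\in\mathbb{R}^{n\times p}$ such that $$\alpha_1 I\preceq P\preceq\alpha_2 I$$ and $$PA_{y}+A_{y}^\top P+RC+C^\top R^\top\preceq-\alpha_3 I\qquad\text{for all } y\in Y.$$ Let $L:=P^{-1}R$, and let $(\hat x(t))_{t\ge0}$ have dynamics $$\dot{\hat x}=A\hat x+N(\hat x)\hat x-L(Cx-C\hat x),\qquad \hat x(0)=\hat x_0\in\mathbb{R}^n .$$ Put $e(t):=x(t)-\hat x(t)$ and $e_0:=x_0-\hat x_0$. If $$\|e_0\|_2=\|x_0-\hat x_0\|_2<\frac{\alpha_3}{2\gamma\alpha_2}\sqrt{\frac{\alpha_1}{\alpha_2}},$$ where $\gamma:=\sigma_{\max}(\Theta)^{1/2}$, then $e(t)\to 0$ as $t\to\infty$.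
   Context: For $d\in\mathbb{R}^n$, $A_d\in\mathbb{R}^{n\times n}$ is the matrix defined by $A_dx:=Ax+N(x)d+N(d)x$ for all $x\in\mathbb{R}^n$. $B_r(d):=\{x\in\mathbb{R}^n:\|x-d\|_2\le r\}$, $r>0$. $\mathcal{S}^n$ is the set of real symmetric $n\times n$ matrices. For a (not necessarily symmetric) square matrix $M$, $M\prec0$ means $x^\top(M+M^\top)x<0$ for all $x\ne0$, and $M\preceq0$ means $x^\top(M+M^\top)x\le0$ for all $x$; $M\preceq M'$ means $M-M'\preceq0$. A set $S\subset\mathbb{R}^n$ is invariant for the dynamical system $\dot x=Ax+N(x)x$ (also phrased: invariant for $(x(t))_{t\ge0}$) if $x(t_0)\in S$ at a time $t_0\ge0$ implies $x(t)\in S$ for all $t\ge t_0$. Definition of $\Theta$: with $\boldsymbol{e}_j$ the standard basis of $\mathbb{R}^n$, define symmetric matrices $Q^{(i)}=(q^{(i)}_{jk})_{j,k=1}^n$, $i=1,\dots,n$, by $q^{(i)}_{jk}:=\tfrac12\left[N(\boldsymbol{e}_j)_{ik}+N(\boldsymbol{e}_k)_{ij}\right]$, so that $N(d)d=(d^\top Q^{(1)}d,\dots,d^\top Q^{(n)}d)^\top$. Define matrices $\tilde Q^{(k)}=(\tilde q^{(k)}_{ij})_{i,j=1}^n$ by $\tilde q^{(k)}_{ij}:=q^{(i)}_{jk}$. Then $\Theta\in\mathbb{R}^{n\times n}$ has entries $\Theta_{i,j}:=\langle\tilde Q^{(i)},\tilde Q^{(j)}\rangle$ with $\langle U,V\rangle=\operatorname{tr}(U^\top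 V)$. $\sigma_{\max}$ denotes the largest singular value.
   Formalization: The formal statement additionally assumes that x_0 lies in B_r(d), without which the claim fails (the trajectory could rest at an equilibrium outside the invariant ball), and reads the bound on e_0 as no restriction when γ = 0. *)

theory Defs
  imports "HOL-Analysis.Analysis"
begin

text \<open>Definiteness of square matrices that need not be symmetric.\<close>

definition neg_def :: "real^'n^'n \<Rightarrow> bool" where
  "neg_def M \<longleftrightarrow> (\<forall>x. x \<noteq> 0 \<longrightarrow> x \<bullet> ((M + transpose M) *v x) < 0)"

definition neg_semidef :: "real^'n^'n \<Rightarrow> bool" where
  "neg_semidef M \<longleftrightarrow> (\<forall>x. x \<bullet> ((M + transpose M) *v x) \<le> 0)"

definition loewner_le :: "real^'n^'n \<Rightarrow> real^'n^'n \<Rightarrow> bool" (infix "\<preceq>" 50) where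
  "M \<preceq> M' \<longleftrightarrow> neg_semidef (M - M')"

definition shifted_mat ::
  "real^'n^'n \<Rightarrow> (real^'n \<Rightarrow> real^'n^'n) \<Rightarrow> real^'n \<Rightarrow> real^'n^'n" where
  "shifted_mat A N d = matrix (\<lambda>x. A *v x + N x *v d + N d *v x)"

text \<open>
  Invariance of a set along one trajectory. Invariance for the dynamical system requires this
  of every trajectory, so as a hypothesis on a given solution this is the weaker condition.
  It says nothing about a trajectory that never meets the set.
\<close>

definition invariant_for :: "(real^'n) set \<Rightarrow> (real \<Rightarrow> real^'n) \<Rightarrow> bool" where
  "invariant_for S x \<longleftrightarrow> (\<forall>t0\<ge>0. x t0 \<in> S \<longrightarrow> (\<forall>t\<ge>t0. x t \<in> S))"

text \<open>
  The symmetric matrices of the quadratic forms given by the components of \<open>N(d)d\<close>, their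
  rearrangement, and the Gram matrix of the latter for the trace inner product.
\<close>

definition Qmat :: "(real^'n \<Rightarrow> real^'n^'n) \<Rightarrow> 'n \<Rightarrow> real^'n^'n" where
  "Qmat N i = (\<chi> j k. (1/2) * (N (axis j 1) $ i $ k + N (axis k 1) $ i $ j))"

definition Qtilde :: "(real^'n \<Rightarrow> real^'n^'n) \<Rightarrow> 'n \<Rightarrow> real^'n^'n" where
  "Qtilde N k = (\<chi> i j. Qmat N i $ j $ k)"

definition Theta :: "(real^'n \<Rightarrow> real^'n^'n) \<Rightarrow> real^'n^'n" where
  "Theta N = (\<chi> i j. trace (transpose (Qtilde N i) ** Qtilde N j))"

definition singular_values :: "real^'n^'n \<Rightarrow> real set" where
  "singular_values M =
     {s. s \<ge> 0 \<and> (\<exists>v. v \<noteq> 0 \<and> (transpose M ** M) *v v = s\<^sup>2 *\<^sub>R v)}"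

definition sigma_max :: "real^'n^'n \<Rightarrow> real" where
  "sigma_max M = Max (singular_values M)"

end

theory Submission
  imports Defs
begin

text \<open>
  The idea is a quadratic Lyapunov function for the error. Subtracting the two equations and
  expanding the quadratic term around \<open>x\<close> gives
  \<open>e' = A\<^sub>x e + L C e - N(e) e\<close> (\<open>observer_error_field\<close>), so that with
  \<open>V = e \<bullet> P e\<close> and \<open>P L = R\<close> the derivative \<open>V'\<close> is the quadratic form of the linear
  matrix inequality at \<open>y = x(t)\<close>, minus the cubic remainder \<open>2 e \<bullet> P N(e) e\<close>.
  The trajectory \<open>x\<close> starts in the invariant ball and so never leaves it, hence the first part is at most
  \<open>-\<alpha>3 |e|\<^sup>2\<close>.

  The remainder is controlled by \<open>\<Theta>\<close>: regrouping coefficients,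
  \<open>N(e) e = M e\<close> for \<open>M\<close> the combination of the matrices \<open>Qtilde N k\<close> with weights \<open>e\<^sub>k\<close>, and
  \<open>\<Theta>\<close> is the Gram matrix of those matrices, so the squared Frobenius norm of \<open>M\<close> is
  \<open>e \<bullet> \<Theta> e\<close>. Bounding this by the largest eigenvalue yields
  \<open>|N(e) e| \<le> \<gamma> |e|\<^sup>2\<close> (\<open>norm_quadratic_term_le\<close>). Cauchy-Schwarz for the form of \<open>P\<close>
  then gives \<open>V' \<le> - (\<alpha>3 - 2 \<alpha>2 \<gamma> |e|) |e|\<^sup>2\<close>.

  For \<open>\<gamma> > 0\<close> the right-hand side is negative only for small nonzero \<open>e\<close>. Since \<open>\<alpha>1 |e|\<^sup>2 \<le> V \<le> \<alpha>2 |e|\<^sup>2\<close>, the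
  smallness of \<open>e(0)\<close> puts \<open>V(0)\<close> strictly below a level \<open>m\<close> such that \<open>V \<le> m\<close> forces
  \<open>V' \<le> - k V\<close> with a fixed \<open>k > 0\<close>. A trajectory of such an inequality cannot climb to the
  level \<open>m\<close>, so it decays exponentially (\<open>exponential_decay_below_threshold\<close>).
\<close>

section \<open>Quadratic forms\<close>

lemma quadratic_form_sym_part:
  fixes M :: "real^'n^'n"
  shows "z \<bullet> ((M + transpose M) *v z) = 2 * (z \<bullet> (M *v z))"
proof -
  have "z \<bullet> (transpose M *v z) = z \<bullet> (M *v z)"
    by (metis dot_lmul_matrix inner_commute transpose_matrix_vector)
  then show ?thesis
    by (simp add: matrix_vector_mult_add_rdistrib inner_add_right)
qed

lemma loewner_le_iff_quadratic_form:
  fixes M M' :: "real^'n^'n"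
  shows "M \<preceq> M' \<longleftrightarrow> (\<forall>z. z \<bullet> (M *v z) \<le> z \<bullet> (M' *v z))"
  by (simp add: loewner_le_def neg_semidef_def quadratic_form_sym_part
      matrix_vector_mult_diff_rdistrib inner_diff_right)

lemma symmetric_matrix_inner_commute:
  fixes B :: "real^'n^'n"
  assumes "transpose B = B"
  shows "u \<bullet> (B *v w) = w \<bullet> (B *v u)"
  by (metis assms dot_lmul_matrix inner_commute transpose_matrix_vector)

text \<open>
  The usual discriminant argument, for a form that may be degenerate. Besides estimating the
  cubic remainder in the form of \<open>P\<close>, it shows that a vector on which such a form vanishes lies
  in the kernel, which is how extremal vectors are recognised as eigenvectors below.
\<close>

lemma psd_Cauchy_Schwarz:
  fixes B :: "real^'n^'n"
  assumes sym: "transpose B = B" and psd: "\<And>z. 0 \<le> z \<bullet> (B *v z)"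
  shows "(u \<bullet> (B *v w))\<^sup>2 \<le> (u \<bullet> (B *v u)) * (w \<bullet> (B *v w))"
proof -
  define a b c where "a = u \<bullet> (B *v u)" and "b = u \<bullet> (B *v w)" and "c = w \<bullet> (B *v w)"
  have wu: "w \<bullet> (B *v u) = b"
    unfolding b_def by (rule symmetric_matrix_inner_commute[OF sym])
  have expand: "(u + t *\<^sub>R w) \<bullet> (B *v (u + t *\<^sub>R w)) = a + 2 * t * b + t\<^sup>2 * c" for t
    using wu
    by (simp add: a_def b_def c_def matrix_vector_right_distrib matrix_vector_mult_scaleR
        inner_add_left inner_add_right power2_eq_square algebra_simps)
  have nonneg: "0 \<le> a + 2 * t * b + t\<^sup>2 * c" for t
    using psd[of "u + t *\<^sub>R w"] unfolding expand .
  have "b\<^sup>2 \<le> a * c"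
  proof (cases "c = 0")
    case True
    have "b = 0"
    proof (rule ccontr)
      assume "b \<noteq> 0"
      \<comment> \<open>with \<open>c = 0\<close> the polynomial is affine; at this point it takes the value \<open>-1\<close>\<close>
      then show False using nonneg[of "- (a + 1) / (2 * b)"] True by (simp add: field_simps)
    qed
    then show ?thesis using True by simp
  next
    case False
    then have "c > 0" using psd[of w] by (simp add: c_def)
    \<comment> \<open>the minimiser of the quadratic polynomial\<close>
    then show ?thesis using nonneg[of "- b / c"] by (simp add: field_simps power2_eq_square)
  qed
  then show ?thesis by (simp add: a_def b_def c_def)
qed

section \<open>The largest singular value of a positive semidefinite matrix\<close>

text \<open>
  Eigenvectors to distinct eigenvalues are orthogonal, hence linearly independent. The finiteness
  makes the maximum in \<open>sigma_max\<close> meaningful.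
\<close>

lemma finite_eigenvalues_symmetric:
  fixes B :: "real^'n^'n"
  assumes sym: "transpose B = B"
  shows "finite {\<mu>. \<exists>v. v \<noteq> 0 \<and> B *v v = \<mu> *\<^sub>R v}" (is "finite ?E")
proof -
  define f where "f \<mu> = (SOME v. v \<noteq> 0 \<and> B *v v = \<mu> *\<^sub>R v)" for \<mu>
  have f: "f \<mu> \<noteq> 0 \<and> B *v f \<mu> = \<mu> *\<^sub>R f \<mu>" if "\<mu> \<in> ?E" for \<mu>
    using someI_ex[of "\<lambda>v. v \<noteq> 0 \<and> B *v v = \<mu> *\<^sub>R v"] that unfolding f_def by blast
  have orth: "f \<mu> \<bullet> f \<nu> = 0" if "\<mu> \<in> ?E" "\<nu> \<in> ?E" "\<mu> \<noteq> \<nu>" for \<mu> \<nu>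
  proof -
    have "f \<mu> \<bullet> (B *v f \<nu>) = f \<nu> \<bullet> (B *v f \<mu>)"
      by (rule symmetric_matrix_inner_commute[OF sym])
    then have "\<nu> * (f \<mu> \<bullet> f \<nu>) = \<mu> * (f \<mu> \<bullet> f \<nu>)"
      using f[OF that(1)] f[OF that(2)] by (simp add: inner_commute)
    then show ?thesis using that(3) by simp
  qed
  have inj: "inj_on f ?E"
  proof (rule inj_onI, rule ccontr)
    fix \<mu> \<nu> assume "\<mu> \<in> ?E" "\<nu> \<in> ?E" "f \<mu> = f \<nu>" "\<mu> \<noteq> \<nu>"
    then show False using orth[of \<mu> \<nu>] f[of \<nu>] by simp
  qed
  have "pairwise orthogonal (f ` ?E)"
    unfolding pairwise_def orthogonal_def using orth by blast
  moreover have "0 \<notin> f ` ?E" using f by force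
  ultimately have "finite (f ` ?E)"
    using pairwise_orthogonal_independent independent_imp_finite by blast
  then show ?thesis using inj by (rule finite_imageD)
qed

lemma finite_singular_values:
  fixes M :: "real^'n^'n"
  shows "finite (singular_values M)"
proof -
  let ?E = "{\<mu>. \<exists>v. v \<noteq> 0 \<and> (transpose M ** M) *v v = \<mu> *\<^sub>R v}"
  have "finite ?E"
    by (rule finite_eigenvalues_symmetric) (simp add: matrix_transpose_mul)
  moreover have "singular_values M \<subseteq> sqrt ` ?E"
  proof
    fix s assume s: "s \<in> singular_values M"
    then have "s\<^sup>2 \<in> ?E" and "sqrt (s\<^sup>2) = s" by (auto simp: singular_values_def)
    then show "s \<in> sqrt ` ?E" by (intro image_eqI[where x = "s\<^sup>2"]) auto
  qed
  ultimately show ?thesis by (meson finite_imageI finite_subset)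
qed

text \<open>
  A maximiser \<open>v\<close> of the form on the unit sphere is the eigenvector: with \<open>\<mu>\<close> the maximal value,
  \<open>\<mu> I - B\<close> is positive semidefinite and its form vanishes at \<open>v\<close>, so Cauchy-Schwarz for that
  form gives \<open>(\<mu> I - B) v = 0\<close>.
\<close>

lemma psd_max_eigenvalue:
  fixes B :: "real^'n^'n"
  assumes sym: "transpose B = B" and psd: "\<And>z. 0 \<le> z \<bullet> (B *v z)"
  obtains \<mu> v where "\<mu> \<ge> 0" "v \<noteq> 0" "B *v v = \<mu> *\<^sub>R v"
    "\<And>z. z \<bullet> (B *v z) \<le> \<mu> * (norm z)\<^sup>2"
proof -
  have "continuous_on (sphere 0 1) (\<lambda>z. z \<bullet> (B *v z))"
    by (intro continuous_intros linear_continuous_on_compose linear_continuous_on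
        matrix_vector_mul_bounded_linear)
  \<comment> \<open>any standard basis vector shows that the sphere is nonempty\<close>
  moreover have "(axis undefined 1 :: real^'n) \<in> sphere 0 1" by simp
  ultimately obtain v where v: "v \<in> sphere 0 1"
    and max: "\<And>z. z \<in> sphere 0 1 \<Longrightarrow> z \<bullet> (B *v z) \<le> v \<bullet> (B *v v)"
    using continuous_attains_sup[OF compact_sphere] by blast
  define \<mu> where "\<mu> = v \<bullet> (B *v v)"
  have bound: "z \<bullet> (B *v z) \<le> \<mu> * (norm z)\<^sup>2" for z
  proof (cases "z = 0")
    case False
    define u where "u = (1 / norm z) *\<^sub>R z"
    have "u \<in> sphere 0 1" using False by (simp add: u_def)
    then have "u \<bullet> (B *v u) \<le> \<mu>" using max \<mu>_def by simp
    moreover have "z = norm z *\<^sub>R u" using False by (simp add: u_def)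
    then have "z \<bullet> (B *v z) = (norm z)\<^sup>2 * (u \<bullet> (B *v u))"
      by (metis inner_scaleR_left inner_scaleR_right matrix_vector_mult_scaleR mult.assoc
          power2_eq_square)
    ultimately show ?thesis using mult_left_mono[of _ _ "(norm z)\<^sup>2"]
      by (simp add: mult.commute)
  qed simp
  let ?D = "\<mu> *\<^sub>R mat 1 - B"
  have D: "?D *v z = \<mu> *\<^sub>R z - B *v z" for z
    by (simp add: matrix_vector_mult_diff_rdistrib scaleR_matrix_vector_assoc[symmetric])
  have Dsym: "transpose ?D = ?D"
    using sym by (simp add: vec_eq_iff transpose_def mat_def)
  have Dpsd: "0 \<le> z \<bullet> (?D *v z)" for z
    using bound[of z] by (simp add: D inner_diff_right power2_norm_eq_inner)
  have "v \<bullet> v = 1" using v by (simp add: dot_square_norm)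
  then have "v \<bullet> (?D *v v) = 0" unfolding D by (simp add: inner_diff_right \<mu>_def)
  then have "((?D *v v) \<bullet> (?D *v v))\<^sup>2 \<le> 0"
    using psd_Cauchy_Schwarz[OF Dsym Dpsd, of "?D *v v" v] by simp
  then have "?D *v v = 0" by simp
  then have "B *v v = \<mu> *\<^sub>R v" by (simp add: D)
  moreover have "v \<noteq> 0" using v by auto
  ultimately show thesis using that psd[of v] bound \<mu>_def by blast
qed

text \<open>
  The maximal eigenvalue \<open>\<mu>\<close> of \<open>B\<close> is itself a singular value, because
  \<open>B\<^sup>T B v = \<mu>\<^sup>2 v\<close> on its eigenvector and \<open>\<mu> \<ge> 0\<close>.
\<close>

lemma psd_le_sigma_max:
  fixes B :: "real^'n^'n"
  assumes sym: "transpose B = B" and psd: "\<And>z. 0 \<le> z \<bullet> (B *v z)"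
  shows "0 \<le> sigma_max B" and "z \<bullet> (B *v z) \<le> sigma_max B * (norm z)\<^sup>2"
proof -
  obtain \<mu> v where \<mu>: "\<mu> \<ge> 0" "v \<noteq> 0" "B *v v = \<mu> *\<^sub>R v"
    and bound: "\<And>z. z \<bullet> (B *v z) \<le> \<mu> * (norm z)\<^sup>2"
    using psd_max_eigenvalue[OF sym psd] by blast
  have "(transpose B ** B) *v v = \<mu>\<^sup>2 *\<^sub>R v"
    using \<mu>(3) by (simp add: sym matrix_vector_mul_assoc[symmetric] matrix_vector_mult_scaleR
        power2_eq_square)
  then have "\<mu> \<in> singular_values B" using \<mu> by (auto simp: singular_values_def)
  then have le: "\<mu> \<le> sigma_max B"
    unfolding sigma_max_def by (rule Max_ge[OF finite_singular_values])
  then show "0 \<le> sigma_max B" using \<mu>(1) by simp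
  show "z \<bullet> (B *v z) \<le> sigma_max B * (norm z)\<^sup>2"
    using bound[of z] mult_right_mono[OF le, of "(norm z)\<^sup>2"] by simp
qed

section \<open>Bounding the quadratic nonlinearity\<close>

text \<open>
  The inner product of the nested vector type is the Frobenius inner product, and likewise its
  norm of a matrix is the Frobenius norm; this is what makes \<open>Theta\<close> a Gram matrix.
\<close>

lemma trace_transpose_mult_eq_inner:
  fixes U V :: "real^'n^'n"
  shows "trace (transpose U ** V) = U \<bullet> V"
proof -
  have "trace (transpose U ** V) = (\<Sum>j\<in>UNIV. \<Sum>i\<in>UNIV. U $ i $ j * V $ i $ j)"
    by (simp add: trace_def matrix_matrix_mult_def transpose_def)
  also have "\<dots> = (\<Sum>i\<in>UNIV. \<Sum>j\<in>UNIV. U $ i $ j * V $ i $ j)"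
    by (rule sum.swap)
  finally show ?thesis by (simp add: inner_vec_def)
qed

lemma quadratic_form_Theta:
  fixes N :: "real^'n \<Rightarrow> real^'n^'n"
  shows "z \<bullet> (Theta N *v z) = (norm (\<Sum>k\<in>UNIV. (z $ k) *\<^sub>R Qtilde N k))\<^sup>2"
proof -
  have "z \<bullet> (Theta N *v z)
    = (\<Sum>i\<in>UNIV. \<Sum>j\<in>UNIV. z $ i * (z $ j * (Qtilde N i \<bullet> Qtilde N j)))"
    by (simp add: Theta_def trace_transpose_mult_eq_inner inner_vec_def[of z]
        matrix_vector_mult_def sum_distrib_left mult_ac)
  then show ?thesis
    by (simp add: power2_norm_eq_inner inner_sum_left inner_sum_right sum_distrib_left
        inner_commute mult.left_commute)
qed

lemma transpose_Theta: "transpose (Theta N) = Theta N"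
proof -
  have "Theta N $ i $ j = Theta N $ j $ i" for i j
    by (simp add: Theta_def trace_transpose_mult_eq_inner inner_commute)
  then show ?thesis by (simp add: vec_eq_iff transpose_def)
qed

lemma norm_matrix_vector_le_norm_mult:
  fixes M :: "real^'n^'m"
  shows "norm (M *v z) \<le> norm M * norm z"
proof (rule power2_le_imp_le)
  have "(norm (M *v z))\<^sup>2 = (\<Sum>i\<in>UNIV. (M $ i \<bullet> z)\<^sup>2)"
    unfolding power2_norm_eq_inner inner_vec_def[of "M *v z"]
    by (simp add: matrix_vector_mul_component power2_eq_square)
  also have "\<dots> \<le> (\<Sum>i\<in>UNIV. (M $ i \<bullet> M $ i) * (z \<bullet> z))"
    by (intro sum_mono Cauchy_Schwarz_ineq)
  also have "\<dots> = (norm M * norm z)\<^sup>2"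
    by (simp add: power_mult_distrib power2_norm_eq_inner inner_vec_def[of M] sum_distrib_right)
  finally show "(norm (M *v z))\<^sup>2 \<le> (norm M * norm z)\<^sup>2" .
qed simp

text \<open>
  The index \<open>k\<close> of the double sum for \<open>(N(z) z)\<^sub>i\<close> is pulled outside as a scalar weight. The
  symmetrisation in \<open>Qmat\<close> splits the right-hand side into two halves that agree after
  renaming the summation indices.
\<close>

lemma quadratic_term_eq_Qtilde:
  fixes N :: "real^'n \<Rightarrow> real^'n^'n"
  assumes "linear N"
  shows "N z *v z = (\<Sum>k\<in>UNIV. (z $ k) *\<^sub>R Qtilde N k) *v z"
proof -
  interpret linear N by fact
  have "N z = (\<Sum>j\<in>UNIV. (z $ j) *\<^sub>R N (axis j 1))"
    by (subst basis_expansion[of z, symmetric]) (simp add: sum scale vector_scalar_mult_def scalar_mult_eq_scaleR)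
  then have Nz: "N z $ i $ k = (\<Sum>j\<in>UNIV. z $ j * N (axis j 1) $ i $ k)" for i k
    by simp
  define S where "S i = (\<Sum>k\<in>UNIV. \<Sum>j\<in>UNIV. z $ j * z $ k * N (axis j 1) $ i $ k)" for i
  have "(N z *v z) $ i = ((\<Sum>k\<in>UNIV. (z $ k) *\<^sub>R Qtilde N k) *v z) $ i" for i
  proof -
    have "(N z *v z) $ i = S i"
      by (simp add: S_def matrix_vector_mult_def Nz sum_distrib_left mult_ac)
    moreover have "((\<Sum>k\<in>UNIV. (z $ k) *\<^sub>R Qtilde N k) *v z) $ i
      = (\<Sum>j\<in>UNIV. \<Sum>k\<in>UNIV. (1/2) * (z $ j * z $ k * N (axis j 1) $ i $ k))
        + (\<Sum>j\<in>UNIV. \<Sum>k\<in>UNIV. (1/2) * (z $ k * z $ j * N (axis k 1) $ i $ j))"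
      by (simp add: matrix_vector_mult_def Qtilde_def Qmat_def sum_distrib_left
          sum.distrib[symmetric] algebra_simps add_divide_distrib)
    moreover have "(\<Sum>j\<in>UNIV. \<Sum>k\<in>UNIV. (1/2) * (z $ j * z $ k * N (axis j 1) $ i $ k))
        = (1/2) * S i"
      unfolding S_def sum_distrib_left by (rule sum.swap)
    moreover have "(\<Sum>j\<in>UNIV. \<Sum>k\<in>UNIV. (1/2) * (z $ k * z $ j * N (axis k 1) $ i $ j))
        = (1/2) * S i"
      unfolding S_def sum_distrib_left ..
    ultimately show ?thesis by simp
  qed
  then show ?thesis by (simp add: vec_eq_iff)
qed

lemma norm_quadratic_term_le:
  fixes N :: "real^'n \<Rightarrow> real^'n^'n"
  assumes "linear N"
  shows "norm (N z *v z) \<le> sqrt (sigma_max (Theta N)) * (norm z)\<^sup>2"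
proof -
  let ?M = "\<Sum>k\<in>UNIV. (z $ k) *\<^sub>R Qtilde N k"
  have "(norm ?M)\<^sup>2 \<le> sigma_max (Theta N) * (norm z)\<^sup>2"
    using psd_le_sigma_max(2)[OF transpose_Theta, of N z] by (simp add: quadratic_form_Theta)
  then have "norm ?M \<le> sqrt (sigma_max (Theta N)) * norm z"
    using real_le_rsqrt real_sqrt_mult by force
  then have "norm ?M * norm z \<le> sqrt (sigma_max (Theta N)) * norm z * norm z"
    by (rule mult_right_mono) simp
  then show ?thesis
    using norm_matrix_vector_le_norm_mult[of ?M z] quadratic_term_eq_Qtilde[OF assms, of z]
    by (simp add: power2_eq_square mult.assoc)
qed

section \<open>Exponential decay from a conditional differential inequality\<close>

text \<open>
  The decay inequality is assumed only where \<open>V \<le> m\<close>. At the first time \<open>u\<close> at which \<open>V\<close> would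
  reach \<open>m\<close>, the inequality has held on all of \<open>[0, u)\<close> and \<open>V\<close> was nonincreasing there, so
  \<open>V u \<le> V 0 < m\<close>, a contradiction. Hence the inequality holds at all times, and
  \<open>V(t) exp (k t)\<close> is nonincreasing.
\<close>

lemma exponential_decay_below_threshold:
  fixes V V' :: "real \<Rightarrow> real" and k m :: real
  assumes deriv: "\<And>t. t \<ge> 0 \<Longrightarrow> (V has_real_derivative V' t) (at t within {0..})"
    and decay: "\<And>t. t \<ge> 0 \<Longrightarrow> V t \<le> m \<Longrightarrow> V' t \<le> - k * V t"
    and nonneg: "\<And>t. t \<ge> 0 \<Longrightarrow> 0 \<le> V t"
    and "0 \<le> k" and "V 0 < m" and "t \<ge> 0"
  shows "V t \<le> V 0 * exp (- k * t)"
proof -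
  have cont: "continuous_on {0..} V"
    by (rule DERIV_continuous_on[of _ _ V']) (use deriv in auto)
  have deriv_at: "(V has_real_derivative V' s) (at s)" if "s > 0" for s
    using deriv[of s] that by (simp add: at_within_interior[of s "{0..}"])
  have below: "V s < m" if "s \<ge> 0" for s
  proof (rule ccontr)
    assume above: "\<not> V s < m"
    define K where "K = {0..s} \<inter> V -` {m..}"
    have "closed K"
      unfolding K_def
      by (rule continuous_closed_preimage[OF continuous_on_subset[OF cont]]) auto
    moreover have "K \<subseteq> {0..s}" by (auto simp: K_def)
    ultimately have "compact K"
      by (metis compact_Icc compact_Int_closed inf.absorb_iff2 inf.commute)
    moreover have "K \<noteq> {}" using above that by (auto simp: K_def)
    ultimately obtain u where u: "u \<in> K" and first: "\<And>w. w \<in> K \<Longrightarrow> u \<le> w"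
      by (meson compact_attains_inf)
    have below_u: "V w \<le> m" if "0 \<le> w" "w < u" for w
      using first[of w] that u by (force simp: K_def)
    have "V u \<le> V 0"
    proof (rule DERIV_nonpos_imp_decreasing_open[where f = V])
      show "0 \<le> u" using u by (simp add: K_def)
      show "continuous_on {0..u} V" using cont by (rule continuous_on_subset) auto
      fix w assume w: "0 < w" "w < u"
      have "V' w \<le> - k * V w" using decay[of w] below_u[of w] w by simp
      also have "\<dots> \<le> 0" using nonneg[of w] w \<open>0 \<le> k\<close> by simp
      finally show "\<exists>y. (V has_real_derivative y) (at w) \<and> y \<le> 0"
        using deriv_at[OF w(1)] by blast
    qed
    then show False using u \<open>V 0 < m\<close> by (simp add: K_def)
  qed
  have "V t * exp (k * t) \<le> V 0 * exp (k * 0)"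
  proof (rule DERIV_nonpos_imp_decreasing_open[where f = "\<lambda>s. V s * exp (k * s)"])
    show "0 \<le> t" by fact
    show "continuous_on {0..t} (\<lambda>s. V s * exp (k * s))"
      by (intro continuous_intros continuous_on_subset[OF cont]) auto
    fix s assume s: "0 < s" "s < t"
    have "((\<lambda>s. V s * exp (k * s)) has_real_derivative (V' s + k * V s) * exp (k * s)) (at s)"
      by (auto intro!: derivative_eq_intros deriv_at[OF s(1)] simp: algebra_simps)
    moreover have "(V' s + k * V s) * exp (k * s) \<le> 0"
      using decay[of s] below[of s] s by (intro mult_nonpos_nonneg) auto
    ultimately show "\<exists>y. ((\<lambda>s. V s * exp (k * s)) has_real_derivative y) (at s) \<and> y \<le> 0"
      by blast
  qed
  then show ?thesis by (simp add: exp_minus field_simps)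
qed

section \<open>Convergence of the observer\<close>

lemma shifted_mat_mult:
  fixes A :: "real^'n^'n"
  assumes "linear N"
  shows "shifted_mat A N d *v z = A *v z + N z *v d + N d *v z"
proof -
  interpret linear N by fact
  have "linear (\<lambda>z. A *v z + N z *v d + N d *v z)"
    by (rule linearI)
      (simp_all add: add scale matrix_vector_right_distrib matrix_vector_mult_add_rdistrib
        matrix_vector_mult_scaleR scaleR_matrix_vector_assoc[symmetric] scaleR_add_right)
  then show ?thesis unfolding shifted_mat_def by (rule matrix_vector_mul(2)[THEN fun_cong])
qed

text \<open>
  The quadratic vector field is expanded around the true state \<open>x\<close>, not around the estimate, so
  that the linear part is the shifted matrix at a point of the invariant ball.
\<close>

lemma observer_error_field:
  fixes A :: "real^'n^'n" and C :: "real^'n^'p" and L :: "real^'p^'n"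
  assumes "linear N"
  shows "(A *v x + N x *v x) - (A *v y + N y *v y - L *v (C *v x - C *v y))
    = shifted_mat A N x *v (x - y) + L *v (C *v (x - y)) - N (x - y) *v (x - y)"
proof -
  interpret linear N by fact
  show ?thesis
    by (simp add: shifted_mat_mult[OF assms] diff matrix_vector_mult_diff_rdistrib
        matrix_vector_right_distrib matrix_vector_mult_diff_distrib)
qed

text \<open>
  The matrix is \<open>G + G\<^sup>T\<close> for \<open>G = P M + R C\<close>, so its form is twice the form of \<open>G\<close>.
\<close>

lemma Lyapunov_quadratic_form:
  fixes P M :: "real^'n^'n" and C :: "real^'n^'p" and R :: "real^'p^'n"
  assumes "transpose P = P"
  shows "z \<bullet> ((P ** M + transpose M ** P + R ** C + transpose C ** transpose R) *v z)
    = 2 * (z \<bullet> (P *v (M *v z) + R *v (C *v z)))"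
proof -
  let ?G = "P ** M + R ** C"
  have "P ** M + transpose M ** P + R ** C + transpose C ** transpose R = ?G + transpose ?G"
    using assms by (simp add: vec_eq_iff transpose_def matrix_matrix_mult_def mult.commute)
  then show ?thesis
    by (simp only: quadratic_form_sym_part)
      (simp add: matrix_vector_mult_add_rdistrib matrix_vector_mul_assoc)
qed

theorem theorem2p6:
  fixes A :: "real^'n^'n"
    and C :: "real^'n^'p"
    and N :: "real^'n \<Rightarrow> real^'n^'n"
    and x xh e :: "real \<Rightarrow> real^'n"
    and x0 xh0 e0 d :: "real^'n"
    and r \<alpha>1 \<alpha>2 \<alpha>3 \<gamma> :: real
    and Y :: "(real^'n) set"
    and P :: "real^'n^'n"
    and R L :: "real^'p^'n"
  assumes N_linear: "linear N"
    and N_energy: "\<And>z. z \<bullet> (N z *v z) = 0"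
    and ex_d': "\<exists>d'. neg_def (shifted_mat A N d')"
    and x_ode: "\<And>t. t \<ge> 0 \<Longrightarrow>
          (x has_vector_derivative (A *v x t + N (x t) *v x t)) (at t within {0..})"
    and x_init: "x 0 = x0"
    and r_pos: "r > 0"
    and ball_invariant: "invariant_for (cball d r) x"
    and x0_in_ball: "x0 \<in> cball d r"
    and ball_subset: "cball d r \<subseteq> Y"
    and alpha_pos: "\<alpha>1 > 0" "\<alpha>2 > 0" "\<alpha>3 > 0"
    and P_sym: "transpose P = P"
    and P_lower: "\<alpha>1 *\<^sub>R mat 1 \<preceq> P"
    and P_upper: "P \<preceq> \<alpha>2 *\<^sub>R mat 1"
    and LMI: "\<And>y. y \<in> Y \<Longrightarrow>
          P ** shifted_mat A N y + transpose (shifted_mat A N y) ** P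
            + R ** C + transpose C ** transpose R \<preceq> - \<alpha>3 *\<^sub>R mat 1"
    and L_eq: "L = matrix_inv P ** R"
    and xh_ode: "\<And>t. t \<ge> 0 \<Longrightarrow>
          (xh has_vector_derivative
             (A *v xh t + N (xh t) *v xh t - L *v (C *v x t - C *v xh t))) (at t within {0..})"
    and xh_init: "xh 0 = xh0"
    and e_eq: "\<And>t. e t = x t - xh t"
    and e0_eq: "e0 = x0 - xh0"
    and gamma_eq: "\<gamma> = sqrt (sigma_max (Theta N))"
    and e0_small: "\<gamma> \<noteq> 0 \<Longrightarrow>
          norm e0 < \<alpha>3 / (2 * \<gamma> * \<alpha>2) * sqrt (\<alpha>1 / \<alpha>2)"
  shows "(e \<longlongrightarrow> 0) at_top"
proof -
  have lower: "\<alpha>1 * (norm z)\<^sup>2 \<le> z \<bullet> (P *v z)"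
    and upper: "z \<bullet> (P *v z) \<le> \<alpha>2 * (norm z)\<^sup>2" for z
    using P_lower P_upper
    by (simp_all add: loewner_le_iff_quadratic_form scaleR_matrix_vector_assoc[symmetric]
        power2_norm_eq_inner)
  have psd: "0 \<le> z \<bullet> (P *v z)" for z
    using lower[of z] alpha_pos(1) by (smt (verit) mult_nonneg_nonneg zero_le_power2)
  have "z = 0" if "P *v z = 0" for z
    using lower[of z] that alpha_pos(1) by (simp add: mult_le_0_iff)
  then have "invertible P"
    by (simp add: invertible_left_inverse matrix_left_invertible_ker)
  then have "P ** matrix_inv P = mat 1"
    unfolding invertible_def matrix_inv_def by (rule someI2_ex) simp
  then have PL: "P ** L = R"
    by (simp add: L_eq matrix_mul_assoc)

  have in_Y: "x t \<in> Y" if "t \<ge> 0" for t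
    using ball_invariant x0_in_ball ball_subset that x_init
    unfolding invariant_for_def by blast
  define F where
    "F t = shifted_mat A N (x t) *v e t + L *v (C *v e t) - N (e t) *v e t" for t
  have e_ode: "(e has_vector_derivative F t) (at t within {0..})" if "t \<ge> 0" for t
  proof -
    have "((\<lambda>t. x t - xh t) has_vector_derivative F t) (at t within {0..})"
      using has_vector_derivative_diff[OF x_ode[OF that] xh_ode[OF that]]
      unfolding observer_error_field[OF N_linear] F_def e_eq .
    moreover have "(\<lambda>t. x t - xh t) = e" by (simp add: e_eq fun_eq_iff)
    ultimately show ?thesis by simp
  qed

  define V where "V t = e t \<bullet> (P *v e t)" for t
  have V_deriv: "(V has_real_derivative 2 * (e t \<bullet> (P *v F t))) (at t within {0..})"
    if "t \<ge> 0" for t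
  proof -
    have "((\<lambda>t. P *v e t) has_vector_derivative P *v F t) (at t within {0..})"
      by (rule bounded_linear.has_vector_derivative[OF _ e_ode[OF that]]) simp
    from bounded_bilinear.has_vector_derivative[OF bounded_bilinear_inner e_ode[OF that] this]
    have "(V has_vector_derivative e t \<bullet> (P *v F t) + F t \<bullet> (P *v e t)) (at t within {0..})"
      by (simp add: V_def[abs_def])
    moreover have "F t \<bullet> (P *v e t) = e t \<bullet> (P *v F t)"
      by (rule symmetric_matrix_inner_commute[OF P_sym])
    ultimately show ?thesis by (simp add: has_real_derivative_iff_has_vector_derivative)
  qed

  have gamma_nonneg: "0 \<le> \<gamma>"
    unfolding gamma_eq
    by (simp add: psd_le_sigma_max(1)[OF transpose_Theta] quadratic_form_Theta)
  have cross: "\<bar>z \<bullet> (P *v (N z *v z))\<bar> \<le> \<alpha>2 * \<gamma> * norm z ^ 3" for z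
  proof -
    let ?n = "N z *v z"
    have "(z \<bullet> (P *v ?n))\<^sup>2 \<le> (z \<bullet> (P *v z)) * (?n \<bullet> (P *v ?n))"
      by (rule psd_Cauchy_Schwarz[OF P_sym psd])
    also have "\<dots> \<le> (\<alpha>2 * (norm z)\<^sup>2) * (\<alpha>2 * (norm ?n)\<^sup>2)"
      using alpha_pos(2) by (intro mult_mono upper psd) auto
    also have "\<dots> = (\<alpha>2 * norm z * norm ?n)\<^sup>2" by (simp add: power_mult_distrib power2_eq_square)
    finally have "\<bar>z \<bullet> (P *v ?n)\<bar> \<le> \<alpha>2 * norm z * norm ?n"
      using alpha_pos(2) by (metis abs_le_square_iff abs_of_nonneg less_imp_le mult_nonneg_nonneg norm_ge_zero)
    also have "\<dots> \<le> \<alpha>2 * norm z * (\<gamma> * (norm z)\<^sup>2)"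
      using norm_quadratic_term_le[OF N_linear, of z] alpha_pos(2)
      by (intro mult_left_mono) (auto simp: gamma_eq)
    finally show ?thesis by (simp add: power2_eq_square power3_eq_cube mult_ac)
  qed
  have V_deriv_le: "2 * (e t \<bullet> (P *v F t)) \<le> - (\<alpha>3 - 2 * \<alpha>2 * \<gamma> * norm (e t)) * (norm (e t))\<^sup>2"
    if "t \<ge> 0" for t
  proof -
    let ?M = "shifted_mat A N (x t)"
    have "P *v F t = P *v (?M *v e t) + R *v (C *v e t) - P *v (N (e t) *v e t)"
      unfolding F_def PL[symmetric]
      by (simp add: matrix_vector_right_distrib matrix_vector_mult_diff_distrib
          matrix_vector_mul_assoc matrix_mul_assoc)
    then have "2 * (e t \<bullet> (P *v F t))
      = 2 * (e t \<bullet> (P *v (?M *v e t) + R *v (C *v e t))) - 2 * (e t \<bullet> (P *v (N (e t) *v e t)))"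
      by (simp add: inner_diff_right)
    also have "2 * (e t \<bullet> (P *v (?M *v e t) + R *v (C *v e t))) \<le> - \<alpha>3 * (norm (e t))\<^sup>2"
      using LMI[OF in_Y[OF that]]
      unfolding loewner_le_iff_quadratic_form Lyapunov_quadratic_form[OF P_sym]
      by (simp add: scaleR_matrix_vector_assoc[symmetric] power2_norm_eq_inner del: scaleR_minus_left)
    finally show ?thesis
      using cross[of "e t"]
      by (simp add: power2_eq_square power3_eq_cube algebra_simps abs_le_iff)
  qed

  have V_bounds: "\<alpha>1 * (norm (e t))\<^sup>2 \<le> V t" "V t \<le> \<alpha>2 * (norm (e t))\<^sup>2" for t
    unfolding V_def by (rule lower, rule upper)
  \<comment> \<open>\<open>V \<le> m\<close> forces \<open>|e| \<le> sqrt (m / \<alpha>1)\<close>, so the second property keeps \<open>V'\<close> below a negative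
    multiple of \<open>|e|\<^sup>2\<close>. When \<open>\<gamma> = 0\<close> there is no cubic remainder and any level above \<open>V 0\<close> works.\<close>
  obtain m where m: "V 0 < m" "2 * \<alpha>2 * \<gamma> * sqrt (m / \<alpha>1) < \<alpha>3"
  proof (cases "\<gamma> = 0")
    case True
    then show thesis using that[of "V 0 + 1"] alpha_pos by simp
  next
    case False
    then have g: "\<gamma> > 0" using gamma_nonneg by simp
    define \<rho> where "\<rho> = \<alpha>3 / (2 * \<gamma> * \<alpha>2)"
    have \<rho>: "\<rho> > 0" using g alpha_pos by (simp add: \<rho>_def)
    have "norm (e 0) < \<rho> * sqrt (\<alpha>1 / \<alpha>2)"
      using e0_small False by (simp add: \<rho>_def e_eq e0_eq x_init xh_init)
    then have "(norm (e 0))\<^sup>2 < (\<rho> * sqrt (\<alpha>1 / \<alpha>2))\<^sup>2"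
      by (intro power_strict_mono) auto
    then have "(norm (e 0))\<^sup>2 < \<rho>\<^sup>2 * (\<alpha>1 / \<alpha>2)"
      using alpha_pos by (simp add: power_mult_distrib)
    then have "V 0 < \<alpha>1 * \<rho>\<^sup>2"
      using V_bounds(2)[of 0] alpha_pos by (simp add: field_simps)
    then obtain m where m: "V 0 < m" "m < \<alpha>1 * \<rho>\<^sup>2" using dense by blast
    have "sqrt (m / \<alpha>1) < \<rho>"
      using m(2) \<rho> alpha_pos by (intro real_less_lsqrt) (auto simp: field_simps)
    then have "2 * \<alpha>2 * \<gamma> * sqrt (m / \<alpha>1) < 2 * \<alpha>2 * \<gamma> * \<rho>" using g alpha_pos by simp
    also have "\<dots> = \<alpha>3" using g alpha_pos by (simp add: \<rho>_def)
    finally show thesis using that m(1) by blast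
  qed
  define \<delta> where "\<delta> = \<alpha>3 - 2 * \<alpha>2 * \<gamma> * sqrt (m / \<alpha>1)"
  have \<delta>: "\<delta> > 0" using m(2) by (simp add: \<delta>_def)
  have V_decay: "V t \<le> V 0 * exp (- (\<delta> / \<alpha>2) * t)" if "t \<ge> 0" for t
  proof (rule exponential_decay_below_threshold[OF V_deriv, where m = m])
    show "0 \<le> V s" for s unfolding V_def by (rule psd)
    show "0 \<le> \<delta> / \<alpha>2" using \<delta> alpha_pos by simp
    fix s :: real assume s: "s \<ge> 0" "V s \<le> m"
    have "(norm (e s))\<^sup>2 \<le> m / \<alpha>1"
      using V_bounds(1)[of s] s(2) alpha_pos by (simp add: field_simps)
    then have "norm (e s) \<le> sqrt (m / \<alpha>1)" by (rule real_le_rsqrt)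
    then have "2 * \<alpha>2 * \<gamma> * norm (e s) \<le> 2 * \<alpha>2 * \<gamma> * sqrt (m / \<alpha>1)"
      using alpha_pos gamma_nonneg by (intro mult_left_mono) auto
    then have "\<delta> * (norm (e s))\<^sup>2 \<le> (\<alpha>3 - 2 * \<alpha>2 * \<gamma> * norm (e s)) * (norm (e s))\<^sup>2"
      unfolding \<delta>_def by (intro mult_right_mono) auto
    then have "2 * (e s \<bullet> (P *v F s)) \<le> - (\<delta> * (norm (e s))\<^sup>2)"
      using V_deriv_le[OF s(1)] unfolding mult_minus_left by linarith
    moreover have "\<delta> / \<alpha>2 * V s \<le> \<delta> / \<alpha>2 * (\<alpha>2 * (norm (e s))\<^sup>2)"
      using V_bounds(2)[of s] \<delta> alpha_pos by (intro mult_left_mono) auto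
    ultimately show "2 * (e s \<bullet> (P *v F s)) \<le> - (\<delta> / \<alpha>2) * V s"
      using alpha_pos by simp
  qed (use m(1) that in auto)

  have "((\<lambda>t. V 0 * exp (- (\<delta> / \<alpha>2) * t) / \<alpha>1) \<longlongrightarrow> 0) at_top"
  proof -
    have "- (\<delta> / \<alpha>2) < 0" using \<delta> alpha_pos by simp
    then have "filterlim (\<lambda>t. - (\<delta> / \<alpha>2) * t) at_bot at_top"
      by (intro filterlim_tendsto_neg_mult_at_bot[OF tendsto_const] filterlim_ident)
    then have "((\<lambda>t. exp (- (\<delta> / \<alpha>2) * t)) \<longlongrightarrow> 0) at_top"
      by (rule filterlim_compose[OF exp_at_bot])
    then have "((\<lambda>t. V 0 * exp (- (\<delta> / \<alpha>2) * t) / \<alpha>1) \<longlongrightarrow> V 0 * 0 / \<alpha>1) at_top"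
      using alpha_pos by (intro tendsto_intros) auto
    then show ?thesis by simp
  qed
  moreover have "(norm (e t))\<^sup>2 \<le> V 0 * exp (- (\<delta> / \<alpha>2) * t) / \<alpha>1" if "t \<ge> 0" for t
    using V_bounds(1)[of t] V_decay[OF that] alpha_pos by (simp add: field_simps)
  then have "\<forall>\<^sub>F t in at_top. (norm (e t))\<^sup>2 \<le> V 0 * exp (- (\<delta> / \<alpha>2) * t) / \<alpha>1"
    by (auto intro: eventually_mono[OF eventually_ge_at_top[of 0]])
  ultimately have "((\<lambda>t. (norm (e t))\<^sup>2) \<longlongrightarrow> 0) at_top"
    using tendsto_sandwich[where f = "\<lambda>_. 0" and g = "\<lambda>t. (norm (e t))\<^sup>2"] by simp
  then have "((\<lambda>t. sqrt ((norm (e t))\<^sup>2)) \<longlongrightarrow> sqrt 0) at_top"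
    by (rule tendsto_real_sqrt)
  then show ?thesis by (simp add: tendsto_norm_zero_iff)
qed

end
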